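(* If $D$ is a digraph such that $P(D)$ has a unique maximal element and $w(P(D))\ge 2$, then $l^*(D)=w(P(D))$.
   Context: A digraph $D$ is finite with nonempty vertex set $V(D)$; loops are allowed, no multiple edges. Trees are finite; a leaf is a vertex of degree 1. Subtrees are nonempty connected subgraphs. A catch-tree representation of $D$ in a host tree $T$ assigns to each vertex $v$ of $D$ a subtree $S_v$ of $T$ (source subtree) and a single vertex $t_v$ of $T$ (sink point) such that, for all $u,v\in V(D)$ (including $u=v$), $uv$ is an edge of $D$ if and only if $t_v\in S_u$. The catch leafage $l^*(D)$ is the minimum number of leaves of a host tree in which $D$ has a catch-tree representation. The incidence poset $P(D)$ is the collection of predecessor sets $N^-(v)=\{u\in V(D): uv\in E(D)\}$, $v\in V(D)$, ordered by inclusion (these are the sets whose incidence vectors are the columns of the adjacency matrix; equal sets give one element). The width $w(P)$ of a poset $P$ is the maximum size of an antichain in $P$. *)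

theory Defs
  imports "Graph_Theory.Graph_Theory"
begin

text \<open>
  A finite digraph that may have loops but has no multiple edges is a \<^locale>\<open>pair_fin_digraph\<close>;
  a finite simple undirected graph is a \<^locale>\<open>pair_graph\<close> (each edge is a pair of opposite arcs).
\<close>

text \<open>
  \<^const>\<open>tree\<close> cannot be used for undirected trees: \<^const>\<open>pre_digraph.cycle\<close> counts an edge
  traversed back and forth as a cycle of length 2. In a \<^locale>\<open>pair_graph\<close> the cycles of the
  underlying undirected graph are exactly those of length at least 3.
\<close>

definition undirected_tree :: "'b pair_pre_digraph \<Rightarrow> bool" where
  "undirected_tree T \<longleftrightarrow>
     pair_graph T \<and> connected T \<and> \<not> (\<exists>p. pre_digraph.cycle T p \<and> 3 \<le> length p)"

definition leaves :: "'b pair_pre_digraph \<Rightarrow> 'b set" where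
  "leaves T = {x \<in> pverts T. out_degree T x = 1}"

text \<open>\<^const>\<open>connected\<close> includes that the vertex set is nonempty.\<close>

definition subtree :: "'b pair_pre_digraph \<Rightarrow> 'b pair_pre_digraph \<Rightarrow> bool" where
  "subtree H T \<longleftrightarrow> pair_graph H \<and> subgraph H T \<and> connected H"

definition catch_tree_representation ::
  "'a pair_pre_digraph \<Rightarrow> 'b pair_pre_digraph \<Rightarrow> ('a \<Rightarrow> 'b pair_pre_digraph) \<Rightarrow> ('a \<Rightarrow> 'b) \<Rightarrow> bool" where
  "catch_tree_representation D T S t \<longleftrightarrow>
     (\<forall>v \<in> pverts D. subtree (S v) T \<and> t v \<in> pverts T) \<and>
     (\<forall>u \<in> pverts D. \<forall>v \<in> pverts D. (u, v) \<in> parcs D \<longleftrightarrow> t v \<in> pverts (S u))"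

text \<open>
  Every finite tree is isomorphic to one on natural numbers, so host trees with vertices in
  \<^typ>\<open>nat\<close> suffice. The minimum exists: every finite digraph has a representation in a star
  whose centre is not a sink point.
\<close>

definition catch_leafage :: "'a pair_pre_digraph \<Rightarrow> nat" where
  "catch_leafage D =
     (LEAST k. \<exists>(T :: nat pair_pre_digraph) S t.
        undirected_tree T \<and> catch_tree_representation D T S t \<and> card (leaves T) = k)"

definition predecessors :: "'a pair_pre_digraph \<Rightarrow> 'a \<Rightarrow> 'a set" where
  "predecessors D v = {u \<in> pverts D. (u, v) \<in> parcs D}"

text \<open>A poset is given by its carrier set; the order is the one of the type, here inclusion.\<close>

definition incidence_poset :: "'a pair_pre_digraph \<Rightarrow> 'a set set" where
  "incidence_poset D = predecessors D ` pverts D"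

definition maximal_in :: "'c::order set \<Rightarrow> 'c \<Rightarrow> bool" where
  "maximal_in P m \<longleftrightarrow> m \<in> P \<and> (\<forall>x \<in> P. \<not> m < x)"

definition antichain :: "'c::order set \<Rightarrow> bool" where
  "antichain A \<longleftrightarrow> pairwise (\<lambda>x y. \<not> x \<le> y) A"

text \<open>Meaningful for finite posets only.\<close>

definition width :: "'c::order set \<Rightarrow> nat" where
  "width P = Max {card A | A. A \<subseteq> P \<and> antichain A}"

end

theory Submission
  imports Defs
begin

text \<open>
  A unique maximal element \<open>M\<close> of the finite poset is its greatest element.

  Lower bound: root the host tree at the sink of \<open>M\<close>. If the sink of \<open>X\<close> lies on the path from
  the root to the sink of \<open>Y\<close>, then every source subtree containing the latter contains the
  whole path, so \<open>Y \<subseteq> X\<close>. Hence the sinks of an antichain are incomparable in the tree order and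
  the leaves beyond them are distinct.

  Upper bound: by Dilworth's theorem the other elements split into \<open>w\<close> chains. Put the sink of \<open>M\<close>
  at the centre of a spider with \<open>w\<close> legs and each chain on a leg, descending outwards; the source
  subtree of a vertex is spanned by the centre and the sinks it has to catch. Each leg ends in an
  additional vertex that is not a sink; it serves as the source subtree of a vertex without
  successors.
\<close>

section \<open>Antichains, width and greatest elements of finite posets\<close>

lemma antichainD: "antichain A \<Longrightarrow> x \<in> A \<Longrightarrow> y \<in> A \<Longrightarrow> x \<le> y \<Longrightarrow> x = y"
  by (auto simp: antichain_def pairwise_def)

lemma finite_antichain_cards: "finite P \<Longrightarrow> finite {card A | A. A \<subseteq> P \<and> antichain A}"
proof -
  assume "finite P"
  have "{card A | A. A \<subseteq> P \<and> antichain A} \<subseteq> card ` Pow P" by auto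
  then show ?thesis using \<open>finite P\<close> by (meson finite_Pow_iff finite_imageI finite_subset)
qed

lemma card_antichain_le_width:
  assumes "finite P" "A \<subseteq> P" "antichain A"
  shows "card A \<le> width P"
  unfolding width_def using assms by (intro Max_ge finite_antichain_cards) auto

lemma width_attained:
  assumes "finite P"
  obtains A where "A \<subseteq> P" "antichain A" "card A = width P"
proof -
  have "card {} \<in> {card A | A. A \<subseteq> P \<and> antichain A}"
    by (rule CollectI, rule exI[of _ "{}"]) (simp add: antichain_def)
  then have "width P \<in> {card A | A. A \<subseteq> P \<and> antichain A}"
    unfolding width_def by (intro Max_in finite_antichain_cards assms) blast
  then show thesis using that by auto
qed

text \<open>By finiteness every element lies below some maximal one, and that one can only be
  \<open>m\<close>.\<close>

lemma unique_maximal_greatest: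
  assumes "finite P" "\<exists>!m. maximal_in P m"
  shows "\<exists>m\<in>P. \<forall>x\<in>P. x \<le> m"
proof -
  obtain m where m: "maximal_in P m" "\<And>y. maximal_in P y \<Longrightarrow> y = m"
    using assms(2) by blast
  have "x \<le> m" if "x \<in> P" for x
  proof -
    obtain y where "y \<in> P" "x \<le> y" "\<And>z. z \<in> P \<Longrightarrow> y \<le> z \<Longrightarrow> y = z"
      using finite_has_maximal2[OF assms(1) \<open>x \<in> P\<close>] by blast
    then have "maximal_in P y" by (auto simp: maximal_in_def less_le_not_le)
    with m(2) \<open>x \<le> y\<close> show ?thesis by blast
  qed
  with m(1) show ?thesis by (auto simp: maximal_in_def)
qed

section \<open>Dilworth's theorem\<close>

text \<open>The induction step of Galvin's proof.\<close>

lemma chain_removal: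
  fixes P :: "'c::order set"
  assumes fin: "finite P" and ne: "P \<noteq> {}"
    and bound: "\<And>A. A \<subseteq> P \<Longrightarrow> antichain A \<Longrightarrow> card A \<le> k"
    and smaller: "\<And>Q. Q \<subset> P \<Longrightarrow> (\<And>A. A \<subseteq> Q \<Longrightarrow> antichain A \<Longrightarrow> card A \<le> k) \<Longrightarrow>
      \<exists>c. (\<forall>x\<in>Q. c x < k) \<and> (\<forall>x\<in>Q. \<forall>y\<in>Q. c x = c y \<longrightarrow> x \<le> y \<or> y \<le> x)"
  obtains K where "K \<subseteq> P" "K \<noteq> {}" "\<forall>x\<in>K. \<forall>y\<in>K. x \<le> y \<or> y \<le> x"
    "\<And>A. A \<subseteq> P - K \<Longrightarrow> antichain A \<Longrightarrow> card A < k"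
proof -
  obtain a where a: "a \<in> P" "\<And>z. z \<in> P \<Longrightarrow> a \<le> z \<Longrightarrow> a = z"
    using finite_has_maximal[OF fin ne] by blast
  let ?Q = "P - {a}"
  let ?big = "\<lambda>A. A \<subseteq> ?Q \<and> antichain A \<and> card A = k"
  show thesis
  proof (cases "\<exists>A. ?big A")
    \<comment> \<open>Removing \<open>a\<close> alone already destroys every antichain of size
      \<open>k\<close>.\<close>
    case False
    show thesis
    proof (rule that[of "{a}"])
      fix A assume A: "A \<subseteq> ?Q" "antichain A"
      then have "card A \<le> k" by (intro bound) auto
      with A False show "card A < k" by (auto simp: le_less)
    qed (use a(1) in auto)
  next
    case True
    have "?Q \<subset> P" using a(1) by blast
    moreover have "card A \<le> k" if "A \<subseteq> ?Q" "antichain A" for A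
      using that by (intro bound) auto
    ultimately obtain c where c: "\<And>x. x \<in> ?Q \<Longrightarrow> c x < k"
      and comp: "\<And>x y. x \<in> ?Q \<Longrightarrow> y \<in> ?Q \<Longrightarrow> c x = c y \<Longrightarrow> x \<le> y \<or> y \<le> x"
      using smaller[of ?Q] by blast
    \<comment> \<open>An antichain meets each of the \<open>k\<close> chains at most once, so one
      with \<open>k\<close> elements meets all of them.\<close>
    have hits: "\<exists>y\<in>A. c y = i" if A: "?big A" and i: "i < k" for A i
    proof -
      have "inj_on c A"
      proof (rule inj_onI)
        fix x y assume "x \<in> A" "y \<in> A" "c x = c y"
        with A comp[of x y] show "x = y" by (auto dest: antichainD)
      qed
      then have "card (c ` A) = k" using A card_image by blast
      moreover have "c ` A \<subseteq> {..<k}" using A c by auto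
      ultimately have "c ` A = {..<k}" by (intro card_subset_eq) auto
      with i show ?thesis by (metis imageE lessThan_iff)
    qed
    \<comment> \<open>The elements of chain \<open>i\<close> that lie on some antichain of size
      \<open>k\<close>; the greatest of them becomes \<open>top i\<close>.\<close>
    define R where "R i = {x. \<exists>A. ?big A \<and> x \<in> A \<and> c x = i}" for i
    have "\<exists>x. x \<in> R i \<and> (\<forall>y \<in> R i. y \<le> x)" if "i < k" for i
    proof -
      have "R i \<subseteq> ?Q" by (auto simp: R_def)
      then have "finite (R i)" using fin finite_subset by blast
      have "R i \<noteq> {}" using True hits[OF _ that] unfolding R_def by blast
      obtain x where x: "x \<in> R i" "\<And>z. z \<in> R i \<Longrightarrow> x \<le> z \<Longrightarrow> x = z"
        using finite_has_maximal[OF \<open>finite (R i)\<close> \<open>R i \<noteq> {}\<close>] by blast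
      have R_c: "c y = i" if "y \<in> R i" for y using that by (auto simp: R_def)
      have "y \<le> x" if "y \<in> R i" for y
      proof -
        have "x \<in> ?Q" "y \<in> ?Q" "c x = c y"
          using \<open>R i \<subseteq> ?Q\<close> x(1) that R_c by auto
        from comp[OF this] x(2)[OF that] show ?thesis by auto
      qed
      with x(1) show ?thesis by blast
    qed
    then obtain top where top: "\<And>i. i < k \<Longrightarrow> top i \<in> R i"
      and top_ge: "\<And>i y. i < k \<Longrightarrow> y \<in> R i \<Longrightarrow> y \<le> top i" by metis
    have top_Q: "top i \<in> ?Q" "c (top i) = i" if "i < k" for i
      using top[OF that] by (auto simp: R_def)
    have below: "\<exists>y\<in>A. c y = i \<and> y \<le> top i" if A: "?big A" and i: "i < k" for A i
      using hits[OF that] top_ge[OF i] A by (auto simp: R_def)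
    \<comment> \<open>If \<open>top i \<le> top j\<close>, an antichain of size \<open>k\<close>
      through \<open>top j\<close> meets chain \<open>i\<close> in some
      \<open>z \<le> top i\<close>. Then \<open>z \<le> top j\<close> forces
      \<open>z = top j\<close>, hence \<open>top i = top j\<close>.\<close>
    have anti: "antichain (top ` {..<k})"
      unfolding antichain_def pairwise_def
    proof (intro ballI impI notI)
      fix x y assume "x \<in> top ` {..<k}" "y \<in> top ` {..<k}" "x \<noteq> y" "x \<le> y"
      then obtain i j where ij: "i < k" "j < k" "x = top i" "y = top j" by auto
      obtain A where A: "?big A" "y \<in> A" using top[OF ij(2)] ij(4) by (auto simp: R_def)
      obtain z where z: "z \<in> A" "c z = i" "z \<le> x" using below[OF A(1) ij(1)] ij(3) by auto
      then have "z = y" using A \<open>x \<le> y\<close> by (meson antichainD order_trans)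
      with z \<open>x \<le> y\<close> \<open>x \<noteq> y\<close> show False by auto
    qed
    \<comment> \<open>Otherwise the maximal element \<open>a\<close> would extend the tops to an
      antichain of size \<open>k + 1\<close>.\<close>
    have "\<exists>i<k. top i \<le> a"
    proof (rule ccontr)
      assume none: "\<not> ?thesis"
      have "\<not> a \<le> top i" if "i < k" for i
        using a(2)[of "top i"] top_Q(1)[OF that] by auto
      then have "antichain (insert a (top ` {..<k}))"
        using anti none by (auto simp: antichain_def pairwise_insert)
      then have "card (insert a (top ` {..<k})) \<le> k"
        using a(1) top_Q(1) by (intro bound) auto
      moreover have "inj_on top {..<k}" using top_Q(2) by (metis inj_onI lessThan_iff)
      moreover have "a \<notin> top ` {..<k}" using top_Q(1) by fastforce
      ultimately show False by (simp add: card_image)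
    qed
    then obtain i where i: "i < k" "top i \<le> a" by blast
    \<comment> \<open>Every antichain of size \<open>k\<close> that avoids \<open>a\<close> meets
      chain \<open>i\<close> at or below \<open>top i\<close>, so none survives the removal of this
      chain.\<close>
    let ?K = "insert a {z \<in> ?Q. c z = i \<and> z \<le> top i}"
    show thesis
    proof (rule that[of ?K])
      show "\<forall>x\<in>?K. \<forall>y\<in>?K. x \<le> y \<or> y \<le> x"
        using comp i(2) by (auto intro: order_trans)
      fix A assume A: "A \<subseteq> P - ?K" "antichain A"
      then have "card A \<le> k" by (intro bound) auto
      moreover have "\<not> ?big A" using below[OF _ i(1), of A] A(1) by blast
      ultimately show "card A < k" using A by (auto simp: le_less)
    qed (use a(1) in auto)
  qed
qed

text \<open>The partition into chains is encoded as a colouring \<open>c\<close>. The chain from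
  \<open>chain_removal\<close> takes colour \<open>k - 1\<close>; antichains outside it have fewer
  than \<open>k\<close> elements, so by induction \<open>k - 1\<close> colours suffice
  there.\<close>

theorem dilworth:
  fixes P :: "'c::order set"
  assumes "finite P" and "\<And>A. A \<subseteq> P \<Longrightarrow> antichain A \<Longrightarrow> card A \<le> k"
  shows "\<exists>c::'c \<Rightarrow> nat. (\<forall>x\<in>P. c x < k) \<and> (\<forall>x\<in>P. \<forall>y\<in>P. c x = c y \<longrightarrow> x \<le> y \<or> y \<le> x)"
  using assms
proof (induction P arbitrary: k rule: finite_psubset_induct)
  case (psubset P)
  show ?case
  proof (cases "P = {}")
    case False
    show ?thesis
    proof (rule chain_removal[OF psubset.hyps False psubset.prems psubset.IH])
      fix K
      assume K: "K \<subseteq> P" "K \<noteq> {}" "\<forall>x\<in>K. \<forall>y\<in>K. x \<le> y \<or> y \<le> x"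
        and less: "\<And>A. A \<subseteq> P - K \<Longrightarrow> antichain A \<Longrightarrow> card A < k"
      \<comment> \<open>The empty antichain shows that \<open>k - 1\<close> is a genuine
        predecessor, hence an admissible colour.\<close>
      have "0 < k" using less[of "{}"] by (simp add: antichain_def)
      have "card A \<le> k - 1" if "A \<subseteq> P - K" "antichain A" for A
        using less[OF that] by simp
      moreover have "P - K \<subset> P" using K by blast
      ultimately have "\<exists>c::'c \<Rightarrow> nat. (\<forall>x\<in>P - K. c x < k - 1) \<and>
          (\<forall>x\<in>P - K. \<forall>y\<in>P - K. c x = c y \<longrightarrow> x \<le> y \<or> y \<le> x)"
        by (intro psubset.IH)
      then obtain c :: "'c \<Rightarrow> nat" where c: "\<And>x. x \<in> P - K \<Longrightarrow> c x < k - 1"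
        "\<And>x y. x \<in> P - K \<Longrightarrow> y \<in> P - K \<Longrightarrow> c x = c y \<Longrightarrow> x \<le> y \<or> y \<le> x"
        by auto
      let ?c = "\<lambda>x. if x \<in> K then k - 1 else c x"
      have "\<forall>x\<in>P. ?c x < k" using c(1) \<open>0 < k\<close> by fastforce
      moreover have "x \<le> y \<or> y \<le> x" if "x \<in> P" "y \<in> P" "?c x = ?c y" for x y
      proof (cases "x \<in> K \<or> y \<in> K")
        case True
        with that c(1)[of x] c(1)[of y] have "x \<in> K" "y \<in> K" by (auto split: if_splits)
        with K(3) show ?thesis by blast
      next
        case False
        with that c(2)[of x y] show ?thesis by auto
      qed
      ultimately show ?thesis by (intro exI[of _ ?c]) blast
    qed
  qed simp
qed


section \<open>Paths in trees\<close>

text \<open>Used to shorten one of two paths until it touches the other only in its last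
  vertex.\<close>

lemma (in pair_wf_digraph) awalk_first_hit:
  assumes "awalk u p v" "v \<in> X"
  obtains p1 p2 w where "p = p1 @ p2" "awalk u p1 w" "awalk w p2 v" "set (awalk_verts u p1) \<inter> X = {w}"
  using assms
proof (induction p arbitrary: u thesis)
  case Nil
  then show ?case by (auto simp: awalk_Nil_iff)
next
  case (Cons e p)
  show ?case
  proof (cases "u \<in> X")
    case True
    with Cons.prems show ?thesis
      by (intro Cons.prems(1)[of "[]" "e # p" u]) (auto simp: awalk_Nil_iff dest: awalk_hd_in_verts)
  next
    case False
    have "awalk (snd e) p v" using Cons.prems(2) by (simp add: awalk_Cons_iff)
    then obtain p1 p2 w where "p = p1 @ p2" "awalk (snd e) p1 w" "awalk w p2 v"
      "set (awalk_verts (snd e) p1) \<inter> X = {w}"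
      using Cons.IH Cons.prems(3) by blast
    with False Cons.prems show ?thesis
      by (intro Cons.prems(1)[of "e # p1" p2 w]) (auto simp: awalk_Cons_iff)
  qed
qed

text \<open>Going from \<open>u\<close> along one branch to \<open>c\<close> and back along the
  other closes a cycle; \<open>a \<noteq> b\<close> prevents it from being one edge traversed back
  and forth.\<close>

lemma (in pair_graph) fork_cycle:
  assumes p: "apath a p c" and q: "apath b q c" and "a \<noteq> b"
    and arcs: "(u, a) \<in> parcs G" "(u, b) \<in> parcs G"
    and u: "u \<notin> set (awalk_verts a p)" "u \<notin> set (awalk_verts b q)"
    and disj: "set (awalk_verts a p) \<inter> set (awalk_verts b q) = {c}"
  shows "\<exists>r. cycle r \<and> 3 \<le> length r"
proof -
  let ?r = "(u, a) # p @ rev_path q @ [(b, u)]"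
  have walks: "awalk a p c" "awalk c (rev_path q) b" "awalk b [(b, u)] u"
    using p q arcs by (auto simp: apath_def awalk_simps arcs_symmetric dest: wellformed')
  have "awalk u ?r u"
    using walks arcs by (auto simp: awalk_simps dest: wellformed')
  moreover have "distinct (tl (awalk_verts u ?r))"
  proof -
    have rq: "awalk_verts c (rev_path q) = rev (awalk_verts b q)"
      using q by (auto simp: apath_def awalk_verts_rev_path)
    have cq: "awalk_verts c (rev_path q) = c # tl (awalk_verts c (rev_path q))"
      using walks(2) by (cases "rev_path q") (auto simp: awalk_simps)
    have "distinct (awalk_verts c (rev_path q))"
      unfolding rq using q by (simp add: apath_def)
    then have d: "distinct (c # tl (awalk_verts c (rev_path q)))"
      using cq by simp
    have s: "set (awalk_verts b q) = insert c (set (tl (awalk_verts c (rev_path q))))"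
      using arg_cong[OF cq, of set] by (simp add: rq)
    \<comment> \<open>The meeting point \<open>c\<close> ends \<open>p\<close> and starts the
      reversed \<open>q\<close>; \<open>tl\<close> makes it count once.\<close>
    have "awalk_verts a (p @ rev_path q @ [(b, u)])
        = awalk_verts a p @ tl (awalk_verts c (rev_path q)) @ [u]"
    proof -
      have w: "awalk c (rev_path q @ [(b, u)]) u" "awalk a (p @ rev_path q @ [(b, u)]) u"
        using walks by auto
      have "awalk_verts c (rev_path q @ [(b, u)]) = awalk_verts c (rev_path q) @ [u]"
        using awalk_verts_append[OF w(1)] walks(2) by simp
      then have "tl (awalk_verts c (rev_path q @ [(b, u)])) = tl (awalk_verts c (rev_path q)) @ [u]"
        by (subst cq) (metis append_Cons cq list.sel(3))
      then show ?thesis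
        using awalk_verts_append[OF w(2)] walks(1) by simp
    qed
    then have eq: "tl (awalk_verts u ?r) = awalk_verts a p @ tl (awalk_verts c (rev_path q)) @ [u]"
      by simp
    have "set (awalk_verts a p) \<inter> set (tl (awalk_verts c (rev_path q))) = {}"
      using disj d unfolding s by auto
    moreover have "u \<notin> set (tl (awalk_verts c (rev_path q)))" using u(2) s by blast
    moreover have "distinct (awalk_verts a p)" using p by (simp add: apath_def)
    ultimately show ?thesis unfolding eq using u(1) d by simp
  qed
  moreover have "3 \<le> length ?r"
  proof (cases "p = [] \<and> q = []")
    case True
    with p q \<open>a \<noteq> b\<close> show ?thesis by (auto simp: apath_Nil_iff)
  next
    case False
    then show ?thesis by (cases p) (auto simp: Suc_le_eq)
  qed
  ultimately show ?thesis unfolding cycle_def by blast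
qed

text \<open>Common initial arcs are dropped by induction. Where the paths diverge, the first is
  followed up to its first vertex on the second, which is the situation of
  \<open>fork_cycle\<close>.\<close>

lemma (in pair_graph) distinct_apaths_cycle:
  assumes "apath u p v" "apath u q v" "p \<noteq> q"
  shows "\<exists>r. cycle r \<and> 3 \<le> length r"
  using assms
proof (induction p arbitrary: u q)
  case Nil
  then show ?case using apath_nonempty_ends[of u q v] by (auto simp: apath_Nil_iff)
next
  case (Cons e p)
  then have "q \<noteq> []" using apath_nonempty_ends[of u "e # p" v] by (auto simp: apath_Nil_iff)
  then obtain f q' where q: "q = f # q'" by (cases q) auto
  show ?case
  proof (cases "e = f")
    case True
    with Cons show ?thesis unfolding q by (auto simp: apath_Cons_iff)
  next
    case False
    define a b where "a = snd e" and "b = snd f"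
    have e: "e = (u, a)" "(u, a) \<in> parcs G" "apath a p v" "u \<notin> set (awalk_verts a p)"
      using Cons.prems(1) by (auto simp: apath_Cons_iff a_def)
    have f: "f = (u, b)" "(u, b) \<in> parcs G" "apath b q' v" "u \<notin> set (awalk_verts b q')"
      using Cons.prems(2) unfolding q by (auto simp: apath_Cons_iff b_def)
    have "awalk a p v" "v \<in> set (awalk_verts b q')" using e(3) f(3) by (auto simp: apath_def)
    then obtain p1 p2 c where p: "p = p1 @ p2" "awalk a p1 c" "awalk c p2 v"
      and c: "set (awalk_verts a p1) \<inter> set (awalk_verts b q') = {c}"
      by (rule awalk_first_hit)
    obtain q1 q2 where q': "q' = q1 @ q2" "awalk b q1 c" "awalk c q2 v"
      using f(3) c unfolding apath_def by (metis IntE awalk_decomp insertI1)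
    have "apath a p1 c" "apath b q1 c"
      using e(3) f(3) p q' by (auto simp: apath_append_iff apath_def awalk_verts_append)
    moreover have "set (awalk_verts a p1) \<subseteq> set (awalk_verts a p)"
      using e(3) p by (auto simp: apath_def set_awalk_verts_append)
    moreover have "set (awalk_verts b q1) \<subseteq> set (awalk_verts b q')"
      using f(3) q' by (auto simp: apath_def set_awalk_verts_append)
    moreover have "c \<in> set (awalk_verts b q1)" using q'(2) by auto
    moreover have "a \<noteq> b" using False e(1) f(1) by blast
    ultimately show ?thesis
      using e f c by (intro fork_cycle[of a p1 c b q1 u]) auto
  qed
qed

lemma connected_apath:
  assumes "pair_graph G" "connected G" "u \<in> pverts G" "v \<in> pverts G"
  shows "\<exists>p. pre_digraph.apath G u p v"
proof -
  interpret pair_graph G by fact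
  have "strongly_connected G"
    using assms(2) sym_arcs by (intro symmetric_connected_imp_strongly_connected)
  then have "u \<rightarrow>\<^sup>*\<^bsub>G\<^esub> v" using assms by (auto simp: strongly_connected_def)
  then show ?thesis by (simp add: reachable_apath)
qed

locale undirected_tree_graph = pair_graph T for T :: "'b pair_pre_digraph" +
  assumes undirected_tree: "undirected_tree T"
begin

lemma unique_apath: "apath u p v \<Longrightarrow> apath u q v \<Longrightarrow> p = q"
  using distinct_apaths_cycle undirected_tree unfolding undirected_tree_def by blast

text \<open>Connectedness gives a path inside \<open>H\<close>; it is also a path of
  \<open>T\<close>, so by uniqueness it is \<open>p\<close>.\<close>

lemma subtree_contains_apath:
  assumes "subtree H T" "u \<in> pverts H" "v \<in> pverts H" "apath u p v"
  shows "set (awalk_verts u p) \<subseteq> pverts H"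
proof -
  interpret H: pair_graph H using assms(1) by (simp add: subtree_def)
  obtain q where q: "H.apath u q v"
    using connected_apath[OF _ _ assms(2,3)] assms(1) unfolding subtree_def by auto
  have Hq: "H.awalk u q v" using q by (simp add: H.apath_def)
  moreover have "pverts H \<subseteq> pverts T" "parcs H \<subseteq> parcs T"
    using assms(1) by (auto simp: subtree_def subgraph_def)
  ultimately have "apath u q v" using q by (auto simp: apath_def awalk_def H.apath_def H.awalk_def)
  with assms(4) have "p = q" by (rule unique_apath)
  with Hq show ?thesis using H.awalk_verts_in_verts by auto
qed

text \<open>Take a longest path from \<open>r\<close> through \<open>x\<close>. A second neighbour
  of its end \<open>z\<close> would extend it if off the path, and would give a second path to
  \<open>z\<close> if on it.\<close>

lemma apath_to_leaf:
  assumes "r \<in> pverts T" "x \<in> pverts T" "x \<noteq> r"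
  obtains p z where "apath r p z" "x \<in> set (awalk_verts r p)" "z \<in> leaves T"
proof -
  let ?P = "\<lambda>p. \<exists>z. apath r p z \<and> x \<in> set (awalk_verts r p)"
  obtain p0 where "apath r p0 x"
    using connected_apath[OF _ _ assms(1,2)] undirected_tree unfolding undirected_tree_def by auto
  then have "?P p0" by (auto simp: apath_def)
  moreover have "\<forall>p. ?P p \<longrightarrow> length p < card (pverts T)"
    using length_apath_less by blast
  ultimately obtain p where p: "?P p" and longest: "\<And>q. ?P q \<Longrightarrow> length q \<le> length p"
    using ex_has_greatest_nat[of ?P p0 length "card (pverts T)"] by (metis less_imp_le)
  obtain z where z: "apath r p z" "x \<in> set (awalk_verts r p)" using p by blast
  then have "p \<noteq> []" using assms(3) by auto
  then obtain p' e where pe: "p = p' @ [e]" by (metis rev_exhaust)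
  define y where "y = fst e"
  have e: "e = (y, z)" "awalk r p' y" "(y, z) \<in> parcs T"
    using z(1) by (auto simp: pe apath_def awalk_simps y_def prod_eq_iff)
  have "w = y" if w: "(z, w) \<in> parcs T" for w
  proof (rule ccontr)
    assume "w \<noteq> y"
    show False
    proof (cases "w \<in> set (awalk_verts r p)")
      case True
      then obtain p1 p2 where split: "p = p1 @ p2" "awalk r p1 w" "awalk w p2 z"
        using z(1) unfolding apath_def by (metis awalk_decomp)
      then have "apath w p2 z"
        using z(1) by (auto simp: apath_append_iff)
      moreover have "apath w [(w, z)] z"
        using w no_loops' by (auto simp: apath_simps arcs_symmetric dest: wellformed')
      ultimately have "p2 = [(w, z)]" by (rule unique_apath)
      then show False using split(1) pe e(1) \<open>w \<noteq> y\<close> by simp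
    next
      case False
      have "awalk z [(z, w)] w" using w by (auto simp: awalk_simps dest: wellformed')
      then have "apath r (p @ [(z, w)]) w"
        using False z(1) by (auto simp: apath_def awalk_verts_append)
      moreover have "x \<in> set (awalk_verts r (p @ [(z, w)]))"
        using calculation z(2) by (auto simp: apath_def set_awalk_verts_append)
      ultimately show False using longest[of "p @ [(z, w)]"] by auto
    qed
  qed
  then have "out_arcs T z = {(z, y)}"
    using e(3) by (auto simp: out_arcs_def arcs_symmetric)
  then have "z \<in> leaves T"
    using e(3) by (auto simp: leaves_def out_degree_def dest: wellformed')
  with z that show thesis by blast
qed

end

section \<open>The lower bound on the number of leaves\<close>

lemma (in undirected_tree_graph) card_antichain_le_leaves:
  assumes rep: "catch_tree_representation D T S t"
    and greatest: "m \<in> pverts D" "\<And>v. v \<in> pverts D \<Longrightarrow> predecessors D v \<subseteq> predecessors D m"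
    and A: "A \<subseteq> incidence_poset D" "antichain A" "2 \<le> card A"
  shows "card A \<le> card (leaves T)"
proof -
  have sub: "subtree (S u) T" and sink: "t u \<in> pverts T" if "u \<in> pverts D" for u
    using rep that by (auto simp: catch_tree_representation_def)
  have pred: "predecessors D v = {u \<in> pverts D. t v \<in> pverts (S u)}" if "v \<in> pverts D" for v
    using rep that by (auto simp: catch_tree_representation_def predecessors_def)
  have "\<exists>v\<in>pverts D. X = predecessors D v" if "X \<in> A" for X
    using that A(1) by (auto simp: incidence_poset_def)
  then obtain v where v: "\<And>X. X \<in> A \<Longrightarrow> v X \<in> pverts D" "\<And>X. X \<in> A \<Longrightarrow> X = predecessors D (v X)"
    by metis
  \<comment> \<open>An antichain containing the greatest predecessor set has no other member, so
    \<open>2 \<le> card A\<close> keeps the chosen sinks away from the root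
    \<open>t m\<close>.\<close>
  have ne: "t (v X) \<noteq> t m" if X: "X \<in> A" for X
  proof
    assume "t (v X) = t m"
    then have eq: "X = predecessors D m"
      using v(2)[OF X] pred[OF v(1)[OF X]] pred[OF greatest(1)] by simp
    have "Y = X" if "Y \<in> A" for Y
      using antichainD[OF A(2) that X] greatest(2)[OF v(1)[OF that]] v(2)[OF that] eq by simp
    then have "A \<subseteq> {X}" by blast
    then have "card A \<le> 1" using card_mono[of "{X}" A] by simp
    with A(3) show False by simp
  qed
  have "\<exists>z p. apath (t m) p z \<and> t (v X) \<in> set (awalk_verts (t m) p) \<and> z \<in> leaves T"
    if "X \<in> A" for X
    using apath_to_leaf[OF sink[OF greatest(1)] sink[OF v(1)[OF that]] ne[OF that]] by metis
  then obtain z p where zp: "\<And>X. X \<in> A \<Longrightarrow> apath (t m) (p X) (z X)"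
    "\<And>X. X \<in> A \<Longrightarrow> t (v X) \<in> set (awalk_verts (t m) (p X))"
    "\<And>X. X \<in> A \<Longrightarrow> z X \<in> leaves T"
    by metis
  \<comment> \<open>A source subtree containing the sink of \<open>Y\<close> also contains that of \<open>m\<close>, hence the path
      between them.\<close>
  have between: "Y \<subseteq> X"
    if XY: "X \<in> A" "Y \<in> A" and q: "apath (t m) q (t (v Y))" "t (v X) \<in> set (awalk_verts (t m) q)"
    for X Y q
  proof
    fix u assume "u \<in> Y"
    then have u: "u \<in> pverts D" "t (v Y) \<in> pverts (S u)"
      using v(2)[OF XY(2)] pred[OF v(1)[OF XY(2)]] by auto
    have "u \<in> predecessors D m" using \<open>u \<in> Y\<close> v XY(2) greatest(2) by blast
    then have "t m \<in> pverts (S u)" using pred[OF greatest(1)] by auto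
    then have "t (v X) \<in> pverts (S u)"
      using subtree_contains_apath[OF sub[OF u(1)] _ u(2) q(1)] q(2) by auto
    then have "u \<in> predecessors D (v X)" using pred[OF v(1)[OF XY(1)]] u(1) by simp
    then show "u \<in> X" using v(2)[OF XY(1)] by simp
  qed
  \<comment> \<open>Equal leaves have equal root paths, and both sinks lie on the common path.
    Whichever comes first, \<open>between\<close> yields an inclusion, which in an antichain is an
    equality.\<close>
  have "inj_on z A"
  proof (rule inj_onI)
    fix X Y assume XY: "X \<in> A" "Y \<in> A" and "z X = z Y"
    then have "p X = p Y" using zp(1) unique_apath by metis
    then have Y: "t (v Y) \<in> set (awalk_verts (t m) (p X))" using zp(2)[OF XY(2)] by simp
    have "awalk (t m) (p X) (z X)" using zp(1)[OF XY(1)] by (simp add: apath_def)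
    then obtain q q' where q: "p X = q @ q'" "awalk (t m) q (t (v Y))" "awalk (t (v Y)) q' (z X)"
      using Y by (metis awalk_decomp)
    have "apath (t m) q (t (v Y))" and q': "apath (t (v Y)) q' (z X)"
      using zp(1)[OF XY(1)] q by (auto simp: apath_append_iff)
    show "X = Y"
    proof (cases "t (v X) \<in> set (awalk_verts (t m) q)")
      case True
      then show ?thesis
        using between[OF XY \<open>apath (t m) q (t (v Y))\<close>] antichainD[OF A(2) XY(2,1)] by blast
    next
      case False
      then have "t (v X) \<in> set (awalk_verts (t (v Y)) q')"
        using zp(1,2)[OF XY(1)] q by (auto simp: apath_def set_awalk_verts_append)
      then obtain r r' where r: "q' = r @ r'" "awalk (t (v Y)) r (t (v X))"
        using q(3) by (metis awalk_decomp)
      have "awalk (t m) (q @ r) (t (v X))" using q(2) r(2) by auto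
      then have "awlast (t m) (q @ r) = t (v X)" by simp
      moreover have "apath (t m) ((q @ r) @ r') (z X)"
        using zp(1)[OF XY(1)] q(1) r(1) by simp
      ultimately have "apath (t m) (q @ r) (t (v X))"
        using apath_append_iff[of "t m" "q @ r" r' "z X"] by simp
      moreover have "t (v Y) \<in> set (awalk_verts (t m) (q @ r))"
        using set_awalk_verts_append[OF q(2) r(2)] hd_in_awalk_verts(1)[OF r(2)] by auto
      ultimately show ?thesis
        using between[OF XY(2,1)] antichainD[OF A(2) XY] by blast
    qed
  qed
  moreover have "z ` A \<subseteq> leaves T" using zp(3) by blast
  moreover have "finite (leaves T)" using pair_finite_verts by (simp add: leaves_def)
  ultimately show ?thesis by (rule card_inj_on_le)
qed

section \<open>Trees from parent functions\<close>

text \<open>The condition \<open>x \<noteq> y\<close> drops loops at fixed points of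
  \<open>f\<close>. One \<open>f\<close> with varying \<open>V\<close> yields both the host tree and
  its subtrees.\<close>

definition parent_graph :: "(nat \<Rightarrow> nat) \<Rightarrow> nat set \<Rightarrow> nat pair_pre_digraph" where
  "parent_graph f V = \<lparr>pverts = V,
     parcs = {(x, y). x \<in> V \<and> y \<in> V \<and> x \<noteq> y \<and> (y = f x \<or> x = f y)}\<rparr>"

lemma parent_graph_simps [simp]:
  "pverts (parent_graph f V) = V"
  "(x, y) \<in> parcs (parent_graph f V) \<longleftrightarrow> x \<in> V \<and> y \<in> V \<and> x \<noteq> y \<and> (y = f x \<or> x = f y)"
  by (auto simp: parent_graph_def)

lemma pair_graph_parent_graph:
  assumes "finite V"
  shows "pair_graph (parent_graph f V)"
proof
  have "parcs (parent_graph f V) \<subseteq> V \<times> V" by auto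
  then show "finite (parcs (parent_graph f V))" using assms finite_subset by blast
  show "symmetric (parent_graph f V)" by (auto simp: symmetric_def intro!: symI)
qed (use assms in auto)

text \<open>Passing to parents strictly decreases the vertex and so ends at \<open>r\<close>; by
  symmetry any two vertices are linked through \<open>r\<close>.\<close>

lemma connected_parent_graph:
  assumes "finite V" "r \<in> V" and parent: "\<And>x. x \<in> V \<Longrightarrow> x \<noteq> r \<Longrightarrow> f x \<in> V \<and> f x < x"
  shows "connected (parent_graph f V)"
proof -
  interpret pair_graph "parent_graph f V" using assms(1) by (rule pair_graph_parent_graph)
  have to_root: "x \<rightarrow>\<^sup>*\<^bsub>parent_graph f V\<^esub> r" if "x \<in> V" for x
    using that
  proof (induction x rule: less_induct)
    case (less x)
    show ?case
    proof (cases "x = r")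
      case False
      then have "(x, f x) \<in> parcs (parent_graph f V)" "f x \<rightarrow>\<^sup>*\<^bsub>parent_graph f V\<^esub> r"
        using less parent[of x] by auto
      then show ?thesis by (meson adj_reachable_trans)
    qed (use assms(2) in auto)
  qed
  have "u \<rightarrow>\<^sup>*\<^bsub>parent_graph f V\<^esub> v" if "u \<in> V" "v \<in> V" for u v
    using to_root[OF that(1)] to_root[OF that(2)] sym_arcs
    by (meson reachable_trans symmetric_reachable)
  moreover have "symcl (parcs (parent_graph f V)) = parcs (parent_graph f V)"
    by (auto simp: symcl_def)
  ultimately show ?thesis
    using assms(2) by (auto simp: connected_conv reachable_def)
qed

lemma subgraph_parent_graph:
  "finite V \<Longrightarrow> U \<subseteq> V \<Longrightarrow> subgraph (parent_graph f U) (parent_graph f V)"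
  using pair_graph_parent_graph[of U f] pair_graph_parent_graph[of V f] finite_subset[of U V]
  by (auto simp: subgraph_def compatible_def wf_digraph_wp_iff pair_graph_def pair_digraph_def
      pair_fin_digraph_def)

lemma pcas_pawalk_verts: "pcas u p v \<Longrightarrow> pawalk_verts u p = u # map snd p"
  by (induction p arbitrary: u) auto

lemma pcas_nth:
  assumes "pcas u p v" "i < length p"
  shows "fst (p ! i) = (u # map snd p) ! i"
  using assms
proof (induction p arbitrary: u i)
  case (Cons e p)
  then show ?case by (cases i) auto
qed simp

text \<open>The modulus treats the closing arc like all others, so that cycles can be handled with
  cyclic indices.\<close>

lemma pcas_closed_nth:
  assumes "pcas u p u" "i < length p"
  shows "fst (p ! (Suc i mod length p)) = snd (p ! i)"
proof (cases "Suc i = length p")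
  case True
  have "fst (p ! 0) = u" using pcas_nth[of u p u 0] assms by (cases p) auto
  moreover have "snd (last p) = v" if "pcas u p v" "p \<noteq> []" for u v and p :: "('a \<times> 'a) list"
    using that by (induction p arbitrary: u) auto
  ultimately show ?thesis
    using True assms by (metis diff_Suc_1 last_conv_nth list.size(3) mod_self not_less_zero)
next
  case False
  then show ?thesis using pcas_nth[of u p u "Suc i"] assms by auto
qed

text \<open>The largest vertex of a cycle cannot be the parent of a smaller one, yet it would have
  two distinct smaller neighbours.\<close>

lemma parent_graph_acyclic:
  assumes "finite V" and decreasing: "\<And>x. f x \<le> x"
  shows "\<not> (\<exists>p. pre_digraph.cycle (parent_graph f V) p \<and> 3 \<le> length p)"
proof
  interpret pair_graph "parent_graph f V" using assms(1) by (rule pair_graph_parent_graph)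
  assume "\<exists>p. cycle p \<and> 3 \<le> length p"
  then obtain p u where u: "awalk u p u" and dist: "distinct (tl (awalk_verts u p))" and n: "3 \<le> length p"
    by (auto simp: cycle_def)
  \<comment> \<open>The heads of the arcs list the vertices of the closed walk without its repeated
    start.\<close>
  define n c where "n = length p" and "c i = snd (p ! i)" for i
  have "pcas u p u" using u by (simp add: awalk_def)
  then have "distinct (map snd p)" using dist by (simp add: pcas_pawalk_verts)
  then have inj: "c i = c j \<Longrightarrow> i < n \<Longrightarrow> j < n \<Longrightarrow> i = j" for i j
    by (auto simp: n_def c_def distinct_conv_nth)
  have arc: "(c i, c (Suc i mod n)) \<in> parcs (parent_graph f V)" if "i < n" for i
  proof -
    have "p ! (Suc i mod n) = (c i, c (Suc i mod n))"
      using pcas_closed_nth[OF \<open>pcas u p u\<close>] that by (auto simp: c_def n_def prod_eq_iff)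
    moreover have "Suc i mod n < n" using that by (intro mod_less_divisor) simp
    then have "p ! (Suc i mod n) \<in> set p" unfolding n_def by (rule nth_mem)
    ultimately show ?thesis using u by (auto simp: awalk_def)
  qed
  have n3: "3 \<le> n" using n by (simp add: n_def)
  then have "finite (c ` {..<n})" "c ` {..<n} \<noteq> {}" by (auto simp: lessThan_empty_iff)
  then have "Max (c ` {..<n}) \<in> c ` {..<n}" by (rule Max_in)
  then obtain i where i: "i < n" and max: "\<And>j. j < n \<Longrightarrow> c j \<le> c i"
    using Max_ge[OF \<open>finite (c ` {..<n})\<close>] by fastforce
  \<comment> \<open>The cyclic successor and predecessor of \<open>i\<close>, which differ because
    \<open>3 \<le> n\<close>.\<close>
  define j k where "j = Suc i mod n" and "k = (if i = 0 then n - 1 else i - 1)"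
  have jk: "j < n" "k < n" "Suc k mod n = i" using i n3 by (auto simp: j_def k_def)
  \<comment> \<open>Both neighbours of the maximal vertex on the cycle have to be its parent.\<close>
  have "c j = f (c i)"
    using arc[OF i] max[OF jk(1)] decreasing[of "c j"] by (auto simp: j_def)
  moreover have "c k = f (c i)"
    using arc[OF jk(2)] max[OF jk(2)] decreasing[of "c k"] by (auto simp: jk(3))
  ultimately have "j = k" using inj jk(1,2) by simp
  then show False
    using i n3 by (auto simp: j_def k_def mod_Suc split: if_splits)
qed

lemma undirected_tree_parent_graph:
  assumes "finite V" "0 \<in> V" "\<And>x. f x \<le> x" "\<And>x. x \<in> V \<Longrightarrow> 0 < x \<Longrightarrow> f x \<in> V \<and> f x < x"
  shows "undirected_tree (parent_graph f V)"
  using assms pair_graph_parent_graph[of V f] connected_parent_graph[of V 0 f]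
    parent_graph_acyclic[of V f]
  unfolding undirected_tree_def by blast

section \<open>The spider\<close>

text \<open>With truncated subtraction, the parent function \<open>x \<mapsto> x - w\<close> turns \<open>{..w * n + w}\<close> into a
  spider with centre \<open>0\<close> and \<open>w\<close> legs (the residue classes of the positive numbers) of length
  \<open>n + 1\<close>.\<close>

definition spider :: "nat \<Rightarrow> nat \<Rightarrow> nat pair_pre_digraph" where
  "spider w n = parent_graph (\<lambda>x. x - w) {..w * n + w}"

lemma undirected_tree_spider: "0 < w \<Longrightarrow> undirected_tree (spider w n)"
  unfolding spider_def by (rule undirected_tree_parent_graph) auto

text \<open>Exactly the last vertices of the legs have no neighbour further out; two legs are needed
  so that the centre is not a leaf.\<close>

lemma leaves_spider:
  assumes "2 \<le> w"
  shows "leaves (spider w n) = {w * n <.. w * n + w}"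
proof -
  have out: "out_arcs (spider w n) x =
      Pair x ` ({x - w} \<union> (if x + w \<le> w * n + w then {x + w} else {}))"
    if "0 < x" "x \<le> w * n + w" for x
    using that assms by (auto simp: spider_def out_arcs_def)
  have deg: "out_degree (spider w n) x = (if x \<le> w * n then 2 else 1)"
    if "0 < x" "x \<le> w * n + w" for x
    unfolding out_degree_def out[OF that] using assms
    by (subst card_image) (auto simp: inj_on_def)
  have deg0: "out_degree (spider w n) 0 \<noteq> 1"
  proof
    assume "out_degree (spider w n) 0 = 1"
    then obtain e where "out_arcs (spider w n) 0 = {e}"
      by (auto simp: out_degree_def card_1_singleton_iff)
    moreover have "{(0, 1), (0, 2)} \<subseteq> out_arcs (spider w n) 0"
      using assms by (auto simp: spider_def out_arcs_def)
    ultimately have "{(0::nat, 1::nat), (0, 2)} \<subseteq> {e}" by simp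
    then show False by (cases e) simp
  qed
  have verts: "pverts (spider w n) = {..w * n + w}" by (simp add: spider_def)
  have "x \<in> leaves (spider w n) \<longleftrightarrow> x \<in> {w * n <.. w * n + w}" for x
  proof (cases "0 < x \<and> x \<le> w * n + w")
    case True
    then have "x \<in> leaves (spider w n) \<longleftrightarrow> \<not> x \<le> w * n"
      using deg[of x] unfolding leaves_def verts by simp
    with True show ?thesis by (simp add: not_le)
  next
    case False
    then show ?thesis using deg0 unfolding leaves_def verts by (cases "x = 0") simp_all
  qed
  then show ?thesis by blast
qed

text \<open>The map \<open>s\<close> places the sinks. The equation
  \<open>s x = s y - k * width P\<close> says that \<open>k\<close> parent steps lead from
  \<open>s y\<close> to \<open>s x\<close>, so \<open>s x\<close> lies between the centre and
  \<open>s y\<close>.\<close>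

lemma spider_embedding:
  fixes P :: "'c::order set"
  assumes fin: "finite P" and greatest: "m \<in> P" "\<And>x. x \<in> P \<Longrightarrow> x \<le> m"
  shows "\<exists>s::'c \<Rightarrow> nat. (\<forall>x\<in>P. s x < width P * card P + width P) \<and>
    (\<forall>x\<in>P. \<forall>y\<in>P. \<forall>k. s x = s y - k * width P \<longrightarrow> y \<le> x)"
proof -
  define w Q where "w = width P" and "Q = P - {m}"
  have "card A \<le> w" if "A \<subseteq> Q" "antichain A" for A
    unfolding w_def using fin that by (intro card_antichain_le_width) (auto simp: Q_def)
  moreover have "finite Q" using fin by (simp add: Q_def)
  ultimately obtain c :: "'c \<Rightarrow> nat" where c: "\<forall>x\<in>Q. c x < w"
    and comp: "\<forall>x\<in>Q. \<forall>y\<in>Q. c x = c y \<longrightarrow> x \<le> y \<or> y \<le> x"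
    using dilworth[of Q w] by auto
  define above where "above x = {y \<in> Q. c y = c x \<and> x < y}" for x
  \<comment> \<open>The colour selects the leg and the number of larger elements in the chain gives
    the depth; the shift by 1 reserves the centre \<open>0\<close> for \<open>m\<close>.\<close>
  define s where "s x = (if x = m then 0 else 1 + c x + w * card (above x))" for x
  have fin_above: "finite (above x)" for x using \<open>finite Q\<close> by (simp add: above_def)
  have "card {m} \<le> w"
    unfolding w_def using fin greatest(1)
    by (intro card_antichain_le_width) (auto simp: antichain_def pairwise_def)
  then have w: "0 < w" by simp
  show ?thesis
    unfolding w_def[symmetric]
  proof (intro exI[of _ s] conjI ballI allI impI)
    fix x assume x: "x \<in> P"
    show "s x < w * card P + w"
    proof (cases "x = m")
      case False
      have "card (above x) < card P"
        using fin x by (intro psubset_card_mono) (auto simp: above_def Q_def)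
      then have "w * Suc (card (above x)) \<le> w * card P" by (intro mult_le_mono2) simp
      moreover have "Suc (c x) \<le> w" using c x False by (simp add: Q_def Suc_le_eq)
      ultimately show ?thesis using False w by (simp add: s_def)
    qed (simp add: s_def w)
  next
    fix x y k assume x: "x \<in> P" and y: "y \<in> P" and eq: "s x = s y - k * w"
    show "y \<le> x"
    proof (cases "x = m")
      case True
      with greatest(2) y show ?thesis by blast
    next
      case False
      \<comment> \<open>Hence the subtraction in \<open>eq\<close> is not truncated.\<close>
      then have "s x \<noteq> 0" by (simp add: s_def)
      with eq have "y \<noteq> m" and sum: "s x + k * w = s y" by (auto simp: s_def)
      with False x y have Q: "x \<in> Q" "y \<in> Q" by (auto simp: Q_def)
      have sum': "c x + w * (card (above x) + k) = c y + w * card (above y)"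
        using sum False \<open>y \<noteq> m\<close> by (simp add: s_def algebra_simps)
      \<comment> \<open>Both colours are below \<open>w\<close>, so they are the residues of the two
        sides.\<close>
      have "c x = c y"
        using arg_cong[OF sum', of "\<lambda>i. i mod w"] c Q by simp
      with sum' w have "card (above x) \<le> card (above y)"
        by (metis add_left_cancel le_add1 mult_cancel1 not_less_iff_gr_or_eq)
      moreover have "card (above y) < card (above x)" if "x < y"
        using that \<open>c x = c y\<close> Q by (intro psubset_card_mono[OF fin_above]) (auto simp: above_def)
      ultimately have "\<not> x < y" by linarith
      then show ?thesis
        using comp Q \<open>c x = c y\<close> unfolding le_less by blast
    qed
  qed
qed

text \<open>By \<open>order\<close>, a sink lying between the centre and a sink caught by
  \<open>u\<close> belongs to a vertex whose predecessors include \<open>u\<close>, so spanning the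
  required sinks catches no unwanted one.\<close>

lemma spider_representation:
  assumes w: "0 < w"
    and bound: "\<And>v. v \<in> pverts D \<Longrightarrow> s (predecessors D v) < w * n + w"
    and order: "\<And>u v k. u \<in> pverts D \<Longrightarrow> v \<in> pverts D \<Longrightarrow>
      s (predecessors D u) = s (predecessors D v) - k * w \<Longrightarrow> predecessors D v \<subseteq> predecessors D u"
  shows "\<exists>S t. catch_tree_representation D (spider w n) S t"
proof -
  define t where "t v = s (predecessors D v)" for v
  \<comment> \<open>All iterated parents of the sinks to be caught. The default
    \<open>w * n + w\<close> is the end of a leg and, by the strict inequality in
    \<open>bound\<close>, not a sink.\<close>
  define U where "U u = (if \<exists>v\<in>pverts D. (u, v) \<in> parcs D
    then {t v - k * w | v k. v \<in> pverts D \<and> (u, v) \<in> parcs D} else {w * n + w})" for u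
  let ?S = "\<lambda>u. parent_graph (\<lambda>x. x - w) (U u)"
  have U_sub: "U u \<subseteq> {..w * n + w}" for u
    using bound by (auto simp: U_def t_def intro: less_imp_le le_trans[OF diff_le_self])
  then have fin: "finite (U u)" for u using finite_subset by blast
  have "connected (?S u)" for u
  proof (cases "\<exists>v\<in>pverts D. (u, v) \<in> parcs D")
    case True
    then obtain v where v: "v \<in> pverts D" "(u, v) \<in> parcs D" by blast
    have U: "U u = {t v - k * w | v k. v \<in> pverts D \<and> (u, v) \<in> parcs D}"
      using True by (simp add: U_def)
    \<comment> \<open>Since \<open>w\<close> is positive, \<open>t v\<close> parent steps certainly
      reach the centre.\<close>
    have "t v - t v * w = 0" using w by simp
    then have "0 \<in> U u" using v unfolding U by (metis (mono_tags, lifting) mem_Collect_eq)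
    moreover have "x - w \<in> U u" if "x \<in> U u" for x
    proof -
      obtain v k where "x = t v - k * w" "v \<in> pverts D" "(u, v) \<in> parcs D"
        using \<open>x \<in> U u\<close> unfolding U by blast
      moreover from this have "x - w = t v - Suc k * w" by simp
      ultimately show ?thesis unfolding U by blast
    qed
    ultimately show ?thesis using fin w by (intro connected_parent_graph[of _ 0]) auto
  next
    case False
    then show ?thesis using fin by (intro connected_parent_graph[of _ "w * n + w"]) (auto simp: U_def)
  qed
  then have "subtree (?S u) (spider w n)" for u
    using fin U_sub unfolding subtree_def spider_def
    by (simp add: pair_graph_parent_graph subgraph_parent_graph)
  moreover have "t v \<in> pverts (spider w n)" if "v \<in> pverts D" for v
    using bound[OF that] by (simp add: spider_def t_def)
  moreover have "(u, v) \<in> parcs D \<longleftrightarrow> t v \<in> U u" if uv: "u \<in> pverts D" "v \<in> pverts D" for u v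
  proof
    assume "(u, v) \<in> parcs D"
    moreover have "\<exists>k. t v = t v - k * w" by (rule exI[of _ 0]) simp
    ultimately show "t v \<in> U u" using uv unfolding U_def by auto
  next
    assume "t v \<in> U u"
    then obtain v' k where "v' \<in> pverts D" "(u, v') \<in> parcs D" "t v = t v' - k * w"
      using bound[OF uv(2)] by (auto simp: U_def t_def split: if_splits)
    then have "u \<in> predecessors D v"
      using order[of v v' k] uv by (auto simp: t_def predecessors_def)
    then show "(u, v) \<in> parcs D" by (simp add: predecessors_def)
  qed
  ultimately have "catch_tree_representation D (spider w n) ?S t"
    by (simp add: catch_tree_representation_def)
  then show ?thesis by blast
qed

theorem theorem9:
  fixes D :: "'a pair_pre_digraph"
  assumes "pair_fin_digraph D" and "pverts D \<noteq> {}"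
    and "\<exists>!M. maximal_in (incidence_poset D) M"
    and "width (incidence_poset D) \<ge> 2"
  shows "catch_leafage D = width (incidence_poset D)"
proof -
  let ?P = "incidence_poset D" and ?w = "width (incidence_poset D)"
  have fin: "finite ?P"
    using pair_fin_digraph.pair_finite_verts[OF assms(1)] by (simp add: incidence_poset_def)
  obtain M where M: "M \<in> ?P" "\<And>X. X \<in> ?P \<Longrightarrow> X \<subseteq> M"
    using unique_maximal_greatest[OF fin assms(3)] by blast
  show ?thesis
    unfolding catch_leafage_def
  proof (rule Least_equality)
    \<comment> \<open>Depths count elements of the poset, so legs of length
      \<open>card ?P + 1\<close> have room for all sinks and a free end.\<close>
    obtain s where "\<forall>X\<in>?P. s X < ?w * card ?P + ?w"
      "\<forall>X\<in>?P. \<forall>Y\<in>?P. \<forall>k. s X = s Y - k * ?w \<longrightarrow> Y \<subseteq> X"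
      using spider_embedding[OF fin M] by blast
    then have "\<exists>S t. catch_tree_representation D (spider ?w (card ?P)) S t"
      using assms(4) by (intro spider_representation[where s = s]) (auto simp: incidence_poset_def)
    moreover have "undirected_tree (spider ?w (card ?P))"
      using assms(4) by (intro undirected_tree_spider) simp
    moreover have "card (leaves (spider ?w (card ?P))) = ?w"
      using assms(4) by (simp add: leaves_spider)
    ultimately show "\<exists>(T :: nat pair_pre_digraph) S t.
        undirected_tree T \<and> catch_tree_representation D T S t \<and> card (leaves T) = ?w"
      by blast
  next
    fix k
    assume "\<exists>(T :: nat pair_pre_digraph) S t.
        undirected_tree T \<and> catch_tree_representation D T S t \<and> card (leaves T) = k"
    then obtain T :: "nat pair_pre_digraph" and S t where T: "undirected_tree T"
      "catch_tree_representation D T S t" "card (leaves T) = k" by blast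
    interpret undirected_tree_graph T
      using T(1) by (simp add: undirected_tree_graph_def undirected_tree_graph_axioms_def undirected_tree_def)
    obtain m where m: "m \<in> pverts D" "predecessors D m = M"
      using M(1) by (auto simp: incidence_poset_def)
    obtain A where A: "A \<subseteq> ?P" "antichain A" "card A = ?w"
      using width_attained[OF fin] .
    have "card A \<le> card (leaves T)"
      using M(2) m A assms(4)
      by (intro card_antichain_le_leaves[OF T(2) m(1)]) (auto simp: incidence_poset_def)
    then show "?w \<le> k" using A(3) T(3) by simp
  qed
qed

end
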